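(* Let $\mathcal X$ be a finite nonempty set of states. Let two imprecise Markov chains on $\mathcal X$ be given by initial upper expectation functionals $\overline E_0,\overline E_0'$ and upper transition operators $\overline T,\overline T'$, and assume both are uniquely convergent, i.e. $\lim_{n\to\infty}\rho(\overline T^n)=0$ and $\lim_{n\to\infty}\rho(\overline T'^n)=0$. For $n\in\mathbb N\cup\{0\}$ put $\overline E_n=\overline E_0\overline T^n$, $\overline E_n'=\overline E_0'\overline T'^n$, $E_n=d(\overline E_n,\overline E_n')$, $D=d(\overline T,\overline T')$ and $\rho_n=\rho(\overline T^n)$. Then for every $n\in\mathbb N\cup\{0\}$, $$E_n\le E_0\,\rho_n+D\sum_{i=0}^{n-1}\rho_i .$$
   Context: $\mathcal L(\mathcal X)$ is the space of all maps $f:\mathcal X\to\mathbb R$, and $\mathcal L_1=\{f\in\mathcal L(\mathcal X): 0\le f(x)\le 1\ \forall x\in\mathcal X\}$. An expectation functional is a map $E(f)=\sum_{x}p(x)f(x)$ with $p$ a probability mass function on $\mathcal X$. A credal set is a nonempty closed convex set $\mathcal M$ of expectation functionals; its upper expectation functional is $\overline E(f)=\max_{E\in\mathcal M}E(f)$. An upper transition operator is a map $\overline T:\mathcal L(\mathcal X)\to\mathcal L(\mathcal X)$, $\overline Tf(x)=\overline T(f|x)$, where for each $x\in\mathcal X$ the functional $\overline T(\cdot|x)$ is an upper expectation functional. Products denote composition, $\overline T^0$ is the identity, and $(\overline E\,\overline T^n)(f)=\overline E(\overline T^nf)$. Distances: $d(\overline E,\overline E')=\max_{f\in\mathcal L_1}|\overline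 E(f)-\overline E'(f)|$ for upper expectation functionals, and $d(\overline T,\overline T')=\max_{x\in\mathcal X}d(\overline T(\cdot|x),\overline T'(\cdot|x))$ for upper transition operators. Weak coefficient of ergodicity: $\rho(\overline T)=\max_{x,y\in\mathcal X}d(\overline T(\cdot|x),\overline T(\cdot|y))$. Empty sums are $0$. *)

theory Defs
  imports "HOL-Analysis.Analysis"
begin

text \<open>
  The state space is a type \<open>'x\<close> of class \<^class>\<open>finite\<close> (hence nonempty).
  Functionals and operators are plain HOL functions; being an expectation functional,
  an upper expectation functional etc. is a predicate on them.
\<close>

type_synonym 'x gamble = "'x \<Rightarrow> real"
type_synonym 'x functional = "'x gamble \<Rightarrow> real"
type_synonym 'x operator = "'x gamble \<Rightarrow> 'x gamble"

definition unit_gambles :: "'x gamble set" where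
  "unit_gambles = {f. \<forall>x. 0 \<le> f x \<and> f x \<le> 1}"

definition mass_functions :: "('x::finite \<Rightarrow> real) set" where
  "mass_functions = {p. (\<forall>x. 0 \<le> p x) \<and> (\<Sum>x\<in>UNIV. p x) = 1}"

definition expectation :: "('x::finite \<Rightarrow> real) \<Rightarrow> 'x functional" where
  "expectation p = (\<lambda>f. \<Sum>x\<in>UNIV. p x * f x)"

definition expectation_functionals :: "'x::finite functional set" where
  "expectation_functionals = expectation ` mass_functions"

text \<open>
  \<open>closed\<close> refers to the product topology on the function space, that is, pointwise
  convergence of functionals.  On linear functionals over the finite-dimensional space
  of gambles this is the usual topology.  Convexity is spelled out because the function
  type is not an instance of the class \<open>real_vector\<close>.
\<close>

definition credal_set :: "'x::finite functional set \<Rightarrow> bool" where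
  "credal_set M \<longleftrightarrow>
     M \<noteq> {} \<and> M \<subseteq> expectation_functionals \<and> closed M \<and>
     (\<forall>E\<in>M. \<forall>E'\<in>M. \<forall>t. 0 \<le> t \<and> t \<le> 1 \<longrightarrow> (\<lambda>f. t * E f + (1 - t) * E' f) \<in> M)"

text \<open>
  The maxima over infinite sets (over a credal set, and over \<^const>\<open>unit_gambles\<close>) are
  written as suprema; \<open>upper_expectation_attained\<close> and \<open>upper_dist_attained\<close>
  below show that they are attained.
\<close>

definition upper_expectation :: "'x::finite functional set \<Rightarrow> 'x functional" where
  "upper_expectation M = (\<lambda>f. SUP E\<in>M. E f)"

definition is_upper_expectation :: "'x::finite functional \<Rightarrow> bool" where
  "is_upper_expectation U \<longleftrightarrow> (\<exists>M. credal_set M \<and> U = upper_expectation M)"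

definition at_state :: "'x operator \<Rightarrow> 'x \<Rightarrow> 'x functional" where
  "at_state T x = (\<lambda>f. T f x)"

definition is_upper_transition_operator :: "'x::finite operator \<Rightarrow> bool" where
  "is_upper_transition_operator T \<longleftrightarrow> (\<forall>x. is_upper_expectation (at_state T x))"

definition upper_dist :: "'x::finite functional \<Rightarrow> 'x functional \<Rightarrow> real" where
  "upper_dist U U' = (SUP f\<in>unit_gambles. \<bar>U f - U' f\<bar>)"

definition transition_dist :: "'x::finite operator \<Rightarrow> 'x operator \<Rightarrow> real" where
  "transition_dist T T' = (MAX x. upper_dist (at_state T x) (at_state T' x))"

definition ergodicity_coeff :: "'x::finite operator \<Rightarrow> real" where
  "ergodicity_coeff T = (MAX (x, y). upper_dist (at_state T x) (at_state T y))"

definition uniquely_convergent :: "'x::finite operator \<Rightarrow> bool" where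
  "uniquely_convergent T \<longleftrightarrow> (\<lambda>n. ergodicity_coeff (T ^^ n)) \<longlonglongrightarrow> 0"

lemma compact_box: "compact {f :: 'x::finite \<Rightarrow> real. \<forall>x. 0 \<le> f x \<and> f x \<le> 1}"
proof -
  have "compactin (product_topology (\<lambda>_::'x. euclideanreal) UNIV) (PiE UNIV (\<lambda>_. {0..1}))"
    by (simp add: compactin_PiE)
  then show ?thesis
    by (simp add: euclidean_product_topology PiE_UNIV_domain Pi_def)
qed

lemma compact_mass_functions: "compact (mass_functions :: ('x::finite \<Rightarrow> real) set)"
proof -
  have c: "continuous_on UNIV (\<lambda>p::'x \<Rightarrow> real. p x)" for x
    by (rule continuous_on_product_coordinates)
  have "closed {p :: 'x \<Rightarrow> real. (\<Sum>x\<in>UNIV. p x) = 1}"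
    by (intro closed_Collect_eq continuous_on_sum c continuous_on_const)
  then have "compact ({f :: 'x \<Rightarrow> real. \<forall>x. 0 \<le> f x \<and> f x \<le> 1} \<inter> {p. (\<Sum>x\<in>UNIV. p x) = 1})"
    using compact_box by (rule compact_Int_closed[rotated])
  moreover have "mass_functions =
      {f :: 'x \<Rightarrow> real. \<forall>x. 0 \<le> f x \<and> f x \<le> 1} \<inter> {p. (\<Sum>x\<in>UNIV. p x) = 1}"
  proof -
    have "p x \<le> 1" if "\<forall>x. 0 \<le> p x" "(\<Sum>x\<in>UNIV. p x) = 1" for p :: "'x \<Rightarrow> real" and x
      using member_le_sum[of x UNIV p] that by simp
    then show ?thesis by (auto simp: mass_functions_def)
  qed
  ultimately show ?thesis by simp
qed

lemma compact_credal_set: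
  assumes "credal_set (M :: 'x::finite functional set)"
  shows "compact M"
proof -
  have "continuous_on UNIV (expectation :: ('x \<Rightarrow> real) \<Rightarrow> 'x functional)"
    unfolding expectation_def
    by (intro continuous_on_coordinatewise_then_product continuous_on_sum
        continuous_on_mult continuous_on_const continuous_on_product_coordinates)
  then have "compact (expectation_functionals :: 'x functional set)"
    unfolding expectation_functionals_def
    using compact_mass_functions
    by (intro compact_continuous_image) (auto intro: continuous_on_subset)
  then have "compact (expectation_functionals \<inter> M)"
    using assms by (intro compact_Int_closed) (auto simp: credal_set_def)
  moreover have "expectation_functionals \<inter> M = M"
    using assms by (auto simp: credal_set_def)
  ultimately show ?thesis by simp
qed

lemma upper_expectation_attained:
  assumes "credal_set M"
  shows "\<exists>E\<in>M. upper_expectation M f = E f \<and> (\<forall>E'\<in>M. E' f \<le> E f)"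
proof -
  have "M \<noteq> {}" using assms by (simp add: credal_set_def)
  moreover have "continuous_on M (\<lambda>E. E f)"
    by (rule continuous_on_subset[OF continuous_on_product_coordinates]) simp
  ultimately obtain E where E: "E \<in> M" "\<forall>E'\<in>M. E' f \<le> E f"
    using continuous_attains_sup[OF compact_credal_set[OF assms], of "\<lambda>E. E f"] by auto
  then have "(SUP E\<in>M. E f) = E f"
    by (intro cSup_eq_maximum) auto
  with E show ?thesis by (auto simp: upper_expectation_def)
qed

lemma upper_expectation_lipschitz:
  assumes "is_upper_expectation U"
  shows "\<bar>U f - U g\<bar> \<le> (\<Sum>x\<in>UNIV. \<bar>f x - g x\<bar>)"
proof -
  obtain M where M: "credal_set M" "U = upper_expectation M"
    using assms by (auto simp: is_upper_expectation_def)
  have E: "E f \<le> E g + (\<Sum>x\<in>UNIV. \<bar>f x - g x\<bar>)" if "E \<in> M" for E f g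
  proof -
    have "E \<in> expectation ` mass_functions"
      using M(1) that unfolding credal_set_def expectation_functionals_def
      by (elim conjE) (rule subsetD)
    then obtain p where p: "p \<in> mass_functions" "E = expectation p"
      by (elim imageE) simp
    have nonneg: "0 \<le> p x" and sum1: "(\<Sum>x\<in>UNIV. p x) = 1" for x
      using p(1) by (auto simp: mass_functions_def)
    have le: "p x \<le> 1" "0 \<le> p x" for x
      using member_le_sum[of x UNIV p] nonneg sum1 by simp_all
    have "p x * f x \<le> p x * g x + \<bar>f x - g x\<bar>" for x
    proof -
      have "p x * (f x - g x) \<le> p x * \<bar>f x - g x\<bar>"
        using le[of x] by (intro mult_left_mono) auto
      also have "\<dots> \<le> \<bar>f x - g x\<bar>"
        using le[of x] by (intro mult_left_le_one_le) auto
      finally show ?thesis by (simp add: algebra_simps)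
    qed
    then have "(\<Sum>x\<in>UNIV. p x * f x) \<le> (\<Sum>x\<in>UNIV. p x * g x + \<bar>f x - g x\<bar>)"
      by (intro sum_mono)
    then show ?thesis
      by (simp add: p(2) expectation_def sum.distrib)
  qed
  have le: "U f \<le> U g + (\<Sum>x\<in>UNIV. \<bar>f x - g x\<bar>)" for f g
  proof -
    obtain F where F: "F \<in> M" "U f = F f"
      using upper_expectation_attained[OF M(1), of f] M(2) by auto
    moreover have "F g \<le> U g"
      using upper_expectation_attained[OF M(1), of g] M(2) F(1) by auto
    ultimately show ?thesis using E[of F f g] by simp
  qed
  have "(\<Sum>x\<in>UNIV. \<bar>g x - f x\<bar>) = (\<Sum>x\<in>UNIV. \<bar>f x - g x\<bar>)"
    by (intro sum.cong) (simp_all add: abs_minus_commute)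
  then show ?thesis using le[of f g] le[of g f] by linarith
qed

lemma continuous_upper_expectation:
  assumes "is_upper_expectation (U :: 'x::finite functional)"
  shows "continuous_on A U"
  unfolding continuous_on_def
proof
  fix f assume "f \<in> A"
  have "((\<lambda>g. g x) \<longlongrightarrow> f x) (at f within A)" for x
  proof -
    have "continuous_on A (\<lambda>g :: 'x gamble. g x)"
      by (rule continuous_on_subset[OF continuous_on_product_coordinates]) simp
    then show ?thesis using \<open>f \<in> A\<close> by (simp add: continuous_on_def)
  qed
  then have "((\<lambda>g. \<Sum>x\<in>UNIV. \<bar>g x - f x\<bar>) \<longlongrightarrow> (\<Sum>x\<in>UNIV. \<bar>f x - f x\<bar>)) (at f within A)"
    by (intro tendsto_intros)
  then have "((\<lambda>g. \<Sum>x\<in>UNIV. \<bar>g x - f x\<bar>) \<longlongrightarrow> 0) (at f within A)"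
    by simp
  then have "((\<lambda>g. U g - U f) \<longlongrightarrow> 0) (at f within A)"
    by (rule Lim_null_comparison[rotated])
       (simp add: upper_expectation_lipschitz[OF assms])
  then show "(U \<longlongrightarrow> U f) (at f within A)"
    by (rule LIM_zero_cancel)
qed

lemma upper_dist_attained:
  fixes U U' :: "'x::finite functional"
  assumes "is_upper_expectation U" "is_upper_expectation U'"
  shows "\<exists>f\<in>unit_gambles. upper_dist U U' = \<bar>U f - U' f\<bar> \<and>
           (\<forall>g\<in>unit_gambles. \<bar>U g - U' g\<bar> \<le> \<bar>U f - U' f\<bar>)"
proof -
  have "compact (unit_gambles :: 'x gamble set)" "(\<lambda>_. 0) \<in> (unit_gambles :: 'x gamble set)"
    using compact_box by (auto simp: unit_gambles_def)
  moreover have "continuous_on unit_gambles (\<lambda>f. \<bar>U f - U' f\<bar>)"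
    by (intro continuous_on_rabs continuous_on_diff continuous_upper_expectation assms)
  ultimately obtain f where f: "f \<in> unit_gambles"
      "\<forall>g\<in>unit_gambles. \<bar>U g - U' g\<bar> \<le> \<bar>U f - U' f\<bar>"
    using continuous_attains_sup[of unit_gambles "\<lambda>f. \<bar>U f - U' f\<bar>"] by auto
  then have "(SUP f\<in>unit_gambles. \<bar>U f - U' f\<bar>) = \<bar>U f - U' f\<bar>"
    by (intro cSup_eq_maximum) auto
  with f show ?thesis by (auto simp: upper_dist_def)
qed

end

theory Submission
  imports Defs
begin

text \<open>
  Every upper expectation functional commutes with positive affine maps and is nonexpansive
  for the supremum norm.  The first property shows that two such functionals \<open>U\<close>, \<open>U'\<close> differ
  on a gamble \<open>g\<close> by at most \<open>upper_dist U U'\<close> times the oscillation of \<open>g\<close>, because \<open>g\<close> is an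
  affine image of a gamble in \<open>unit_gambles\<close> with slope its oscillation.  The second shows that
  replacing \<open>g\<close> by a gamble \<open>g'\<close> within distance \<open>c\<close> costs at most \<open>c\<close>.  Together they
  give the perturbation step \<open>\<bar>U g - U' g'\<bar> \<le> upper_dist U U' * r + c\<close>
  when \<open>g\<close> oscillates by at most \<open>r\<close> (lemma \<open>upper_expectation_perturbation\<close>).

  For \<open>f\<close> in \<open>unit_gambles\<close> the oscillation of \<open>(T ^^ i) f\<close> is at most the ergodicity coefficient
  of \<open>T ^^ i\<close>, by the very definition of that coefficient.  Hence one application of
  \<open>T\<close> against \<open>T'\<close> after \<open>i\<close> steps adds at most \<open>transition_dist T T'\<close> times this coefficient
  to the distance between \<open>(T ^^ i) f\<close> and \<open>(T' ^^ i) f\<close>, and the sum in the bound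
  accumulates these errors.  The initial functionals contribute one last perturbation step, with
  the oscillation of \<open>(T ^^ n) f\<close>.
\<close>

lemma upper_expectation_le_shift:
  assumes "is_upper_expectation U" and "\<And>x. f x \<le> g x + c"
  shows "U f \<le> U g + c"
proof -
  obtain M where M: "credal_set M" "U = upper_expectation M"
    using assms(1) by (auto simp: is_upper_expectation_def)
  \<comment> \<open>The maximiser for \<open>f\<close> is merely a competitor for \<open>g\<close>.\<close>
  obtain E where E: "E \<in> M" "U f = E f"
    using upper_expectation_attained[OF M(1), of f] M(2) by auto
  have "E g \<le> U g"
    using upper_expectation_attained[OF M(1), of g] M(2) E(1) by auto
  moreover have "E f \<le> E g + c"
  proof -
    obtain p where p: "p \<in> mass_functions" "E = expectation p"
      using M(1) E(1) unfolding credal_set_def expectation_functionals_def by blast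
    have "(\<Sum>x\<in>UNIV. p x * f x) \<le> (\<Sum>x\<in>UNIV. p x * (g x + c))"
      using p(1) assms(2) by (intro sum_mono mult_left_mono) (auto simp: mass_functions_def)
    also have "\<dots> = (\<Sum>x\<in>UNIV. p x * g x) + c"
      using p(1) by (simp add: mass_functions_def distrib_left sum.distrib
          flip: sum_distrib_right)
    finally show ?thesis by (simp add: p(2) expectation_def)
  qed
  ultimately show ?thesis using E(2) by simp
qed

lemma upper_expectation_nonexpansive:
  assumes "is_upper_expectation U" and "\<And>x. \<bar>f x - g x\<bar> \<le> c"
  shows "\<bar>U f - U g\<bar> \<le> c"
proof -
  have "f x \<le> g x + c" "g x \<le> f x + c" for x
    using assms(2)[of x] by linarith+
  then show ?thesis
    using upper_expectation_le_shift[OF assms(1), of f g c]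
      upper_expectation_le_shift[OF assms(1), of g f c] by fastforce
qed

lemma upper_expectation_affine:
  assumes "is_upper_expectation U" and "0 \<le> a"
  shows "U (\<lambda>x. a * f x + b) = a * U f + b"
proof -
  obtain M where M: "credal_set M" "U = upper_expectation M"
    using assms(1) by (auto simp: is_upper_expectation_def)
  have aff: "E (\<lambda>x. a * f x + b) = a * E f + b" if E: "E \<in> M" for E
  proof -
    obtain p where p: "p \<in> mass_functions" "E = expectation p"
      using M(1) E unfolding credal_set_def expectation_functionals_def by blast
    have "(\<Sum>x\<in>UNIV. p x * (a * f x + b)) = a * (\<Sum>x\<in>UNIV. p x * f x) + (\<Sum>x\<in>UNIV. p x) * b"
      by (simp add: distrib_left sum.distrib sum_distrib_left sum_distrib_right mult.left_commute)
    then show ?thesis using p by (simp add: expectation_def mass_functions_def)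
  qed
  \<comment> \<open>A nonnegative slope preserves the order, so the two gambles have a common maximiser.\<close>
  obtain E where E: "E \<in> M" "U f = E f" "\<forall>E'\<in>M. E' f \<le> E f"
    using upper_expectation_attained[OF M(1), of f] M(2) by auto
  obtain F where F: "F \<in> M" "U (\<lambda>x. a * f x + b) = F (\<lambda>x. a * f x + b)"
      "\<forall>E'\<in>M. E' (\<lambda>x. a * f x + b) \<le> F (\<lambda>x. a * f x + b)"
    using upper_expectation_attained[OF M(1), of "\<lambda>x. a * f x + b"] M(2) by auto
  have "a * F f + b \<le> a * E f + b"
    using E(3) F(1) assms(2) by (simp add: mult_left_mono)
  moreover have "a * E f + b \<le> a * F f + b"
    using F(3) E(1) aff[OF E(1)] aff[OF F(1)] by fastforce
  ultimately have "a * F f = a * E f" by linarith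
  then show ?thesis using aff[OF F(1)] F(2) E(2) by simp
qed

lemma upper_expectation_unit_interval:
  assumes "is_upper_expectation U" and "f \<in> unit_gambles"
  shows "0 \<le> U f \<and> U f \<le> 1"
proof -
  have const: "U (\<lambda>_. 0) = 0"
    using upper_expectation_affine[OF assms(1), of 0 "\<lambda>_. 0" 0] by simp
  have "0 \<le> f x" "f x \<le> 1" for x using assms(2) by (auto simp: unit_gambles_def)
  then show ?thesis
    using upper_expectation_le_shift[OF assms(1), of f "\<lambda>_. 0" 1]
      upper_expectation_le_shift[OF assms(1), of "\<lambda>_. 0" f 0] const by simp
qed

lemma upper_transition_operator_at:
  assumes "is_upper_transition_operator T"
  shows "is_upper_expectation (\<lambda>f. T f x)"
  using assms by (simp add: is_upper_transition_operator_def at_state_def)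

lemma funpow_unit_gambles:
  assumes "is_upper_transition_operator T" and "f \<in> unit_gambles"
  shows "(T ^^ n) f \<in> unit_gambles"
proof (induction n)
  case (Suc n)
  then show ?case
    using upper_expectation_unit_interval[OF upper_transition_operator_at[OF assms(1)]]
    by (simp add: unit_gambles_def)
qed (use assms(2) in simp)

text \<open>
  The functionals are only asked to map \<open>unit_gambles\<close> into the unit interval, which keeps the
  supremum in \<open>upper_dist\<close> finite.  The functionals \<open>at_state (T ^^ n) x\<close> satisfy
  this at once, so no credal set has to be built for an iterated operator.
\<close>

lemma abs_diff_le_upper_dist:
  assumes U: "\<And>g. g \<in> unit_gambles \<Longrightarrow> 0 \<le> U g \<and> U g \<le> 1"
    and V: "\<And>g. g \<in> unit_gambles \<Longrightarrow> 0 \<le> V g \<and> V g \<le> 1"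
    and f: "f \<in> unit_gambles"
  shows "\<bar>U f - V f\<bar> \<le> upper_dist U V"
  unfolding upper_dist_def
proof (rule cSUP_upper[OF f bdd_aboveI2])
  fix g :: "'a gamble"
  assume "g \<in> unit_gambles"
  then show "\<bar>U g - V g\<bar> \<le> 1"
    using U[of g] V[of g] by linarith
qed

lemma oscillation_funpow_le_ergodicity_coeff:
  assumes T: "is_upper_transition_operator T" and f: "f \<in> unit_gambles"
  shows "\<bar>(T ^^ n) f x - (T ^^ n) f y\<bar> \<le> ergodicity_coeff (T ^^ n)"
proof -
  have unit: "0 \<le> at_state (T ^^ n) z g \<and> at_state (T ^^ n) z g \<le> 1"
    if "g \<in> unit_gambles" for z g
    using funpow_unit_gambles[OF T that, of n] by (simp add: at_state_def unit_gambles_def)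
  have "\<bar>(T ^^ n) f x - (T ^^ n) f y\<bar> \<le> upper_dist (at_state (T ^^ n) x) (at_state (T ^^ n) y)"
    using abs_diff_le_upper_dist[OF unit[where z = x] unit[where z = y] f] by (simp add: at_state_def)
  also have "\<dots> \<le> ergodicity_coeff (T ^^ n)"
    unfolding ergodicity_coeff_def
    by (rule Max_ge) (auto intro!: image_eqI[where x = "(x, y)"])
  finally show ?thesis .
qed

text \<open>
  The distance only tests gambles with values in the unit interval; subtracting the minimum
  of \<open>g\<close> and dividing by \<open>r\<close> brings \<open>g\<close> there, and \<open>upper_expectation_affine\<close> scales the
  estimate back.
\<close>

lemma abs_diff_le_upper_dist_oscillation:
  assumes U: "is_upper_expectation U" and U': "is_upper_expectation U'"
    and osc: "\<And>x y. \<bar>g x - g y\<bar> \<le> r"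
  shows "\<bar>U g - U' g\<bar> \<le> upper_dist U U' * r"
proof -
  define m where "m = Min (range g)"
  have m_le: "m \<le> g x" for x by (simp add: m_def)
  have "m \<in> range g" unfolding m_def by (rule Min_in) auto
  then obtain x0 where x0: "m = g x0" by blast
  have r: "0 \<le> r" using osc[of x0 x0] by simp
  have le_m: "g x \<le> m + r" for x using osc[of x x0] x0 by linarith
  \<comment> \<open>If \<open>r = 0\<close> then \<open>g\<close> is constant and \<open>h\<close> is the zero gamble, division by zero being zero.\<close>
  define h where "h = (\<lambda>x. (g x - m) / r)"
  have h: "h \<in> unit_gambles"
  proof -
    have "0 \<le> h x \<and> h x \<le> 1" for x
      using m_le[of x] le_m[of x] r by (cases "r = 0") (auto simp: h_def divide_le_eq_1)
    then show ?thesis by (simp add: unit_gambles_def)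
  qed
  have "g x = r * h x + m" for x
    using m_le[of x] le_m[of x] by (cases "r = 0") (auto simp: h_def)
  then have g: "g = (\<lambda>x. r * h x + m)" by (rule ext)
  have "U g = r * U h + m" "U' g = r * U' h + m"
    unfolding g by (rule upper_expectation_affine[OF U r] upper_expectation_affine[OF U' r])+
  then have "U g - U' g = r * (U h - U' h)" by (simp add: right_diff_distrib)
  then have "\<bar>U g - U' g\<bar> = r * \<bar>U h - U' h\<bar>" using r by (simp add: abs_mult)
  also have "\<dots> \<le> r * upper_dist U U'"
    using abs_diff_le_upper_dist[of U U' h] upper_expectation_unit_interval U U' h r
    by (intro mult_left_mono) blast+
  finally show ?thesis by (simp add: mult.commute)
qed

text \<open>
  The intermediate value is \<open>U' g\<close>: the oscillation that enters is that of \<open>g\<close>, so that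
  the bounds below involve the iterates of \<open>T\<close> alone.
\<close>

lemma upper_expectation_perturbation:
  assumes "is_upper_expectation U" and "is_upper_expectation U'"
    and "\<And>x y. \<bar>g x - g y\<bar> \<le> r" and "\<And>x. \<bar>g x - g' x\<bar> \<le> c"
  shows "\<bar>U g - U' g'\<bar> \<le> upper_dist U U' * r + c"
proof -
  have "\<bar>U g - U' g\<bar> \<le> upper_dist U U' * r"
    using assms(1,2,3) by (rule abs_diff_le_upper_dist_oscillation)
  moreover have "\<bar>U' g - U' g'\<bar> \<le> c"
    using assms(2,4) by (rule upper_expectation_nonexpansive)
  ultimately show ?thesis by linarith
qed

lemma funpow_transition_dist:
  assumes T: "is_upper_transition_operator T" and T': "is_upper_transition_operator T'"
    and f: "f \<in> unit_gambles"
  shows "\<bar>(T ^^ n) f x - (T' ^^ n) f x\<bar>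
     \<le> transition_dist T T' * (\<Sum>i<n. ergodicity_coeff (T ^^ i))"
proof (induction n arbitrary: x)
  case (Suc n)
  let ?\<rho> = "ergodicity_coeff (T ^^ n)"
  let ?S = "\<Sum>i<n. ergodicity_coeff (T ^^ i)"
  have "\<bar>T ((T ^^ n) f) x - T' ((T' ^^ n) f) x\<bar>
      \<le> upper_dist (at_state T x) (at_state T' x) * ?\<rho> + transition_dist T T' * ?S"
    unfolding at_state_def
    by (rule upper_expectation_perturbation[OF upper_transition_operator_at[OF T]
          upper_transition_operator_at[OF T']
          oscillation_funpow_le_ergodicity_coeff[OF T f] Suc.IH])
  also have "upper_dist (at_state T x) (at_state T' x) * ?\<rho> \<le> transition_dist T T' * ?\<rho>"
  proof (rule mult_right_mono)
    show "upper_dist (at_state T x) (at_state T' x) \<le> transition_dist T T'"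
      by (simp add: transition_dist_def)
    show "0 \<le> ?\<rho>"
      using oscillation_funpow_le_ergodicity_coeff[OF T f, of n x x] by simp
  qed
  finally show ?case by (simp add: distrib_left)
qed simp

theorem theorem2:
  fixes U0 U0' :: "'x::finite functional"
    and T T' :: "'x operator"
    and n :: nat
  assumes "is_upper_expectation U0" and "is_upper_expectation U0'"
    and "is_upper_transition_operator T" and "is_upper_transition_operator T'"
    and "uniquely_convergent T" and "uniquely_convergent T'"
  shows "upper_dist (U0 \<circ> T ^^ n) (U0' \<circ> T' ^^ n)
     \<le> upper_dist U0 U0' * ergodicity_coeff (T ^^ n)
        + transition_dist T T' * (\<Sum>i<n. ergodicity_coeff (T ^^ i))"
  unfolding upper_dist_def[of "U0 \<circ> T ^^ n"]
proof (rule cSUP_least)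
  have "(\<lambda>_. 0) \<in> (unit_gambles :: 'x gamble set)" by (simp add: unit_gambles_def)
  then show "(unit_gambles :: 'x gamble set) \<noteq> {}" by blast
next
  fix f :: "'x gamble"
  assume f: "f \<in> unit_gambles"
  show "\<bar>(U0 \<circ> T ^^ n) f - (U0' \<circ> T' ^^ n) f\<bar>
     \<le> upper_dist U0 U0' * ergodicity_coeff (T ^^ n)
        + transition_dist T T' * (\<Sum>i<n. ergodicity_coeff (T ^^ i))"
    unfolding comp_apply
    by (rule upper_expectation_perturbation[OF assms(1,2)
          oscillation_funpow_le_ergodicity_coeff[OF assms(3) f]
          funpow_transition_dist[OF assms(3,4) f]])
qed

end
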